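(* There exist polynomials $a_{n,k}(q)\in\mathbb{N}[q]$ (for integers $n\ge 1$ and $k\in\mathbb{Z}$) such that for every positive integer $n$ the $q$-Eulerian polynomial $A_n(t,q)$ can be written as $$A_n(t,q)=\sum_{k=1}^{\lfloor (n+1)/2\rfloor} a_{n,k}(q)\,t^{k-1}\,(-tq^{k};q)_{n+1-2k}.$$ Moreover, these polynomials satisfy the recurrence relation $$a_{n,k}(q)=[k]_q\,a_{n-1,k}(q)+(1+q^{k-1})\,q^{k-1}\,[n+2-2k]_q\,a_{n-1,k-1}(q)$$ for $n\ge 2$ and $1\le k\le \lfloor (n+1)/2\rfloor$, with $a_{1,1}(q)=1$ and $a_{n,k}(q)=0$ for $k\le 0$ or $k>\lfloor (n+1)/2\rfloor$.
   Context: Notation: $q$ and $t$ are indeterminates; $\mathbb{N}=\{0,1,2,\dots\}$, so $\mathbb{N}[q]$ is the set of polynomials in $q$ with nonnegative integer coefficients; $[m]_q=1+q+\cdots+q^{m-1}$ with $[0]_q=0$; $(x;q)_m=(1-x)(1-xq)\cdots(1-xq^{m-1})$ with $(x;q)_0=1$. Carlitz's $q$-Eulerian polynomials $A_n(t,q)$ (polynomials in $t$ with coefficients in $\mathbb{Z}[q]$) are defined by the generating function identity $$\sum_{k\ge 0}[k+1]_q^n\,t^k=\frac{A_n(t,q)}{(t;q)_{n+1}}.$$ *)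

theory Defs
  imports "HOL-Computational_Algebra.Polynomial_FPS"
begin

text \<open>
  Polynomials in the indeterminate \<open>q\<close> are elements of \<^typ>\<open>int poly\<close> (or \<^typ>\<open>nat poly\<close> for
  coefficients in the natural numbers); polynomials in \<open>t\<close> over these are elements of
  \<^typ>\<open>int poly poly\<close>, the outer variable being \<open>t\<close>.
\<close>

definition q_nat :: "'a::comm_semiring_1 \<Rightarrow> nat \<Rightarrow> 'a" where
  "q_nat q m = (\<Sum>i<m. q ^ i)"

definition q_poch :: "'a::comm_ring_1 \<Rightarrow> 'a \<Rightarrow> nat \<Rightarrow> 'a" where
  "q_poch x q m = (\<Prod>i<m. 1 - x * q ^ i)"

definition indet_q :: "'a::comm_semiring_1 poly" where
  "indet_q = [:0, 1:]"

definition indet_t :: "int poly poly" where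
  "indet_t = [:0, 1:]"

text \<open>
  The generating function identity is an identity of formal power series in \<open>t\<close> over \<open>\<int>[q]\<close>, with
  the denominator (whose constant term is 1) multiplied out.
\<close>

definition q_eulerian :: "nat \<Rightarrow> int poly poly" where
  "q_eulerian n = (THE A.
     Abs_fps (\<lambda>k. q_nat indet_q (k + 1) ^ n) * fps_of_poly (q_poch indet_t [:indet_q:] (n + 1))
       = fps_of_poly A)"

lemma geometric_fps: "Abs_fps (\<lambda>k. c ^ k) * fps_of_poly [:1, - c:] = 1"
  for c :: "'a::comm_ring_1"
proof (rule fps_ext)
  fix n
  show "fps_nth (Abs_fps (\<lambda>k. c ^ k) * fps_of_poly [:1, - c:]) n = fps_nth 1 n"
    by (cases n) (simp_all add: fps_of_poly_pCons ring_distribs mult.commute[of _ c] mult.assoc[symmetric])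
qed

lemma q_eulerian_exists:
  "\<exists>A. Abs_fps (\<lambda>k. q_nat indet_q (k + 1) ^ n) * fps_of_poly (q_poch indet_t [:indet_q:] (n + 1))
       = fps_of_poly A"
  (is "\<exists>A. ?F * fps_of_poly ?P = _")
proof -
  let ?q = "indet_q :: int poly"
  define G where "G j = Abs_fps (\<lambda>k. (?q ^ j) ^ k)" for j :: nat
  define d where "d j = of_nat (n choose j) * (- 1) ^ j * ?q ^ j" for j
  define B where "B = (\<Sum>j\<le>n. smult (d j) (\<Prod>i\<in>{..<n + 1} - {j}. [:1, - (?q ^ i):]))"
  have P: "?P = (\<Prod>i<n + 1. [:1, - (?q ^ i):])"
    unfolding q_poch_def
    by (intro prod.cong refl)
       (simp add: indet_t_def one_pCons poly_const_pow)
  have geo: "(1 - ?q) * q_nat ?q m = 1 - ?q ^ m" for m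
    unfolding q_nat_def by (rule one_diff_power_eq[symmetric])
  have F: "fps_const ((1 - ?q) ^ n) * ?F = (\<Sum>j\<le>n. fps_const (d j) * G j)"
  proof (rule fps_ext)
    fix k
    have "(1 - ?q) ^ n * q_nat ?q (k + 1) ^ n = (- (?q ^ (k + 1)) + 1) ^ n"
      by (simp only: flip: power_mult_distrib) (simp only: geo, simp)
    also have "\<dots> = (\<Sum>j\<le>n. of_nat (n choose j) * (- (?q ^ (k + 1))) ^ j * 1 ^ (n - j))"
      by (rule binomial_ring)
    also have "\<dots> = (\<Sum>j\<le>n. d j * (?q ^ j) ^ k)"
      by (intro sum.cong refl, subst power_minus)
         (simp add: d_def power_mult_distrib power_add mult_ac flip: power_mult)
    finally show "fps_nth (fps_const ((1 - ?q) ^ n) * ?F) k = fps_nth (\<Sum>j\<le>n. fps_const (d j) * G j) k"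
      by (simp add: fps_sum_nth G_def)
  qed
  have GP: "G j * fps_of_poly ?P = fps_of_poly (\<Prod>i\<in>{..<n + 1} - {j}. [:1, - (?q ^ i):])"
    if "j \<le> n" for j
  proof -
    have "?P = [:1, - (?q ^ j):] * (\<Prod>i\<in>{..<n + 1} - {j}. [:1, - (?q ^ i):])"
      unfolding P using that by (intro prod.remove) auto
    then show ?thesis
      by (simp only: G_def fps_of_poly_mult geometric_fps mult_1 flip: mult.assoc)
  qed
  have eq: "fps_const ((1 - ?q) ^ n) * (?F * fps_of_poly ?P) = fps_of_poly B"
  proof -
    have "fps_const ((1 - ?q) ^ n) * (?F * fps_of_poly ?P)
        = (\<Sum>j\<le>n. fps_const (d j) * (G j * fps_of_poly ?P))"
      by (subst mult.assoc[symmetric]) (simp only: F sum_distrib_right mult.assoc)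
    also have "\<dots> = fps_of_poly B"
      unfolding B_def fps_of_poly_sum by (intro sum.cong refl) (simp only: GP fps_of_poly_smult atMost_iff)
    finally show ?thesis .
  qed
  have nz: "(1 - ?q) ^ n \<noteq> 0"
    by (simp add: indet_q_def one_pCons)
  have z: "fps_nth (?F * fps_of_poly ?P) m = 0" if "m > degree B" for m
    using arg_cong[OF eq, of "\<lambda>f. fps_nth f m"] nz that by (auto simp: coeff_eq_0)
  have "?F * fps_of_poly ?P = fps_of_poly (Abs_poly (fps_nth (?F * fps_of_poly ?P)))"
  proof (rule fps_ext)
    fix m
    have "coeff (Abs_poly (fps_nth (?F * fps_of_poly ?P))) = fps_nth (?F * fps_of_poly ?P)"
      by (rule coeff_Abs_poly) (rule z)
    then show "fps_nth (?F * fps_of_poly ?P) m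
        = fps_nth (fps_of_poly (Abs_poly (fps_nth (?F * fps_of_poly ?P)))) m"
      by simp
  qed
  then show ?thesis by blast
qed

lemma q_eulerian_generating_function:
  "Abs_fps (\<lambda>k. q_nat indet_q (k + 1) ^ n) * fps_of_poly (q_poch indet_t [:indet_q:] (n + 1))
     = fps_of_poly (q_eulerian n)"
  unfolding q_eulerian_def
  by (rule theI') (metis q_eulerian_exists fps_of_poly_eq_iff)

end

theory Submission
  imports Defs
begin

text \<open>
  Since \<open>(1 - q) [k + 1]\<^sub>q = 1 - q\<^sup>k\<^sup>+\<^sup>1\<close>, the series \<open>F\<^sub>n(t) = \<Sum>\<^sub>k [k + 1]\<^sub>q\<^sup>n t\<^sup>k\<close> satisfies
  \<open>(1 - q) F\<^sub>n\<^sub>+\<^sub>1(t) = F\<^sub>n(t) - q F\<^sub>n(q t)\<close>. Clearing denominators turns this into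
  \<open>(1 - q) A\<^sub>n\<^sub>+\<^sub>1(t) = (1 - t q\<^sup>n\<^sup>+\<^sup>1) A\<^sub>n(t) - q (1 - t) A\<^sub>n(q t)\<close> (lemma \<open>q_eulerian_Suc\<close>).

  The linear operator on the right maps the basis polynomial
  \<open>B\<^sub>n\<^sub>,\<^sub>k = t\<^sup>k\<^sup>-\<^sup>1 (- t q\<^sup>k; q)\<^bsub>n+1-2k\<^esub>\<close> to the combination
  \<open>(1 - q) ([k]\<^sub>q B\<^sub>n\<^sub>+\<^sub>1\<^sub>,\<^sub>k + (1 + q\<^sup>k) q\<^sup>k [n + 1 - 2k]\<^sub>q B\<^sub>n\<^sub>+\<^sub>1\<^sub>,\<^sub>k\<^sub>+\<^sub>1)\<close> of basis polynomials
  (lemma \<open>euler_op_gamma_basis\<close>). Hence the coefficients defined by the recurrence of the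
  theorem are those of \<open>A\<^sub>n\<close> in this basis, by induction on \<open>n\<close>; the recurrence
  involves no subtraction of polynomials, so they have nonnegative coefficients.
\<close>

section \<open>The \<open>q\<close>-shifted factorial\<close>

lemma q_poch_0 [simp]: "q_poch x q 0 = 1"
  by (simp add: q_poch_def)

lemma q_poch_Suc: "q_poch x q (Suc m) = q_poch x q m * (1 - x * q ^ m)"
  by (simp add: q_poch_def)

lemma q_poch_Suc_shift: "q_poch x q (Suc m) = (1 - x) * q_poch (x * q) q m"
  unfolding q_poch_def by (subst prod.lessThan_Suc_shift) (simp add: mult.assoc)

lemma q_nat_Suc: "q_nat q (Suc m) = q_nat q m + q ^ m"
  by (simp add: q_nat_def)

lemma pcompose_power: "pcompose (p ^ m) r = pcompose p r ^ m"
  for p r :: "'a::comm_ring_1 poly"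
  by (induction m) (simp_all add: pcompose_1 pcompose_mult)

lemma pcompose_q_poch:
  "pcompose (q_poch x y m) r = q_poch (pcompose x r) (pcompose y r) m"
  by (simp add: q_poch_def pcompose_prod pcompose_diff pcompose_mult pcompose_power pcompose_1)

lemma q_nat_geometric: "(1 - q) * q_nat q m = 1 - q ^ m"
  for q :: "'a::comm_ring_1"
  unfolding q_nat_def by (rule one_diff_power_eq[symmetric])

section \<open>The recurrence of the \<open>q\<close>-Eulerian polynomials\<close>

text \<open>The indeterminate \<open>q\<close> as an element of \<open>\<int>[q][t]\<close>.\<close>
definition const_q :: "int poly poly" where
  "const_q = [:indet_q:]"

lemma pcompose_const_q [simp]: "pcompose const_q p = const_q"
  by (simp add: const_q_def)

text \<open>
  The operator \<open>f(t) \<mapsto> (1 - t q\<^sup>n\<^sup>+\<^sup>1) f(t) - q (1 - t) f(q t)\<close>; the substitution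
  \<open>t \<mapsto> q t\<close> is polynomial composition with \<open>q t\<close>.
\<close>
definition euler_op :: "nat \<Rightarrow> int poly poly \<Rightarrow> int poly poly" where
  "euler_op n f = (1 - indet_t * const_q ^ Suc n) * f
     - const_q * (1 - indet_t) * pcompose f (indet_t * const_q)"

lemma euler_op_sum: "euler_op n (\<Sum>k\<in>A. [:c k:] * f k) = (\<Sum>k\<in>A. [:c k:] * euler_op n (f k))"
proof -
  have "euler_op n (g + h) = euler_op n g + euler_op n h" for g h
    by (simp add: euler_op_def pcompose_add algebra_simps)
  moreover have "euler_op n 0 = 0"
    by (simp add: euler_op_def)
  moreover have "euler_op n ([:c:] * g) = [:c:] * euler_op n g" for c g
    unfolding euler_op_def pcompose_mult pcompose_const by (simp only: algebra_simps)
  ultimately show ?thesis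
    by (induction A rule: infinite_finite_induct) auto
qed

lemma pcompose_indet_t: "pcompose indet_t (indet_t * const_q) = indet_t * const_q"
  by (simp add: indet_t_def pcompose_pCons const_q_def)

lemma one_minus_const_q_nonzero: "1 - const_q \<noteq> 0"
  by (simp add: one_pCons indet_q_def const_q_def)

text \<open>The series \<open>F\<^sub>n(t) = \<Sum>\<^sub>k [k + 1]\<^sub>q\<^sup>n t\<^sup>k\<close>.\<close>
definition q_power_series :: "nat \<Rightarrow> int poly fps" where
  "q_power_series n = Abs_fps (\<lambda>k. q_nat indet_q (k + 1) ^ n)"

lemma q_power_series_Suc:
  "fps_const (1 - indet_q) * q_power_series (Suc n)
     = q_power_series n - fps_const indet_q * (q_power_series n oo (fps_const indet_q * fps_X))"
proof (rule fps_ext)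
  fix k
  let ?m = "q_nat (indet_q :: int poly) (k + 1)"
  have "(1 - indet_q) * ?m ^ Suc n = ((1 - indet_q) * ?m) * ?m ^ n"
    by (simp only: power_Suc mult.assoc)
  also have "\<dots> = ?m ^ n - indet_q * (indet_q ^ k * ?m ^ n)"
    by (simp only: q_nat_geometric) (simp add: algebra_simps)
  finally show "fps_nth (fps_const (1 - indet_q) * q_power_series (Suc n)) k
      = fps_nth (q_power_series n
          - fps_const indet_q * (q_power_series n oo (fps_const indet_q * fps_X))) k"
    by (simp add: q_power_series_def)
qed

lemma q_eulerian_Suc: "(1 - const_q) * q_eulerian (Suc n) = euler_op n (q_eulerian n)"
proof -
  let ?D = "\<lambda>n. q_poch indet_t const_q (Suc n)"
  let ?s = "indet_t * const_q"
  have gf: "q_power_series n * fps_of_poly (?D n) = fps_of_poly (q_eulerian n)" for n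
    using q_eulerian_generating_function[of n] by (simp add: q_power_series_def const_q_def)
  have q: "fps_of_poly const_q = fps_const indet_q"
    by (simp add: const_q_def)
  have s: "fps_of_poly ?s = fps_const indet_q * fps_X"
    by (simp add: indet_t_def const_q_def fps_of_poly_pCons)
  have gf_s: "(q_power_series n oo fps_of_poly ?s) * fps_of_poly (pcompose (?D n) ?s)
      = fps_of_poly (pcompose (q_eulerian n) ?s)"
  proof -
    have "coeff ?s 0 = 0"
      by (simp add: indet_t_def)
    then show ?thesis
      by (simp add: fps_of_poly_pcompose fps_compose_mult_distrib flip: gf)
  qed
  have D: "?D (Suc n) = ?D n * (1 - indet_t * const_q ^ Suc n)"
    by (rule q_poch_Suc)
  have D_s: "?D (Suc n) = (1 - indet_t) * pcompose (?D n) ?s"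
    by (simp only: q_poch_Suc_shift[of _ _ "Suc n"] pcompose_q_poch pcompose_indet_t pcompose_const_q)
  have "fps_of_poly ((1 - const_q) * q_eulerian (Suc n))
      = fps_const (1 - indet_q) * q_power_series (Suc n) * fps_of_poly (?D (Suc n))"
    by (simp add: fps_of_poly_mult mult.assoc const_q_def fps_of_poly_diff flip: gf fps_const_sub)
  also have "\<dots> = q_power_series n * fps_of_poly (?D (Suc n))
      - fps_of_poly const_q * (q_power_series n oo fps_of_poly ?s) * fps_of_poly (?D (Suc n))"
    by (simp only: q_power_series_Suc s q left_diff_distrib)
  also have "q_power_series n * fps_of_poly (?D (Suc n))
      = fps_of_poly ((1 - indet_t * const_q ^ Suc n) * q_eulerian n)"
    by (simp only: D fps_of_poly_mult mult_ac flip: gf)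
  also have "fps_of_poly const_q * (q_power_series n oo fps_of_poly ?s) * fps_of_poly (?D (Suc n))
      = fps_of_poly (const_q * (1 - indet_t) * pcompose (q_eulerian n) ?s)"
    by (simp only: D_s fps_of_poly_mult mult_ac flip: gf_s)
  finally show ?thesis
    by (simp only: euler_op_def flip: fps_of_poly_diff fps_of_poly_eq_iff)
qed

section \<open>The operator on the basis polynomials\<close>

text \<open>
  The polynomial \<open>B\<^sub>n\<^sub>,\<^sub>k = t\<^sup>k\<^sup>-\<^sup>1 (- t q\<^sup>k; q)\<^bsub>n+1-2k\<^esub>\<close>. It is meaningful for \<open>1 \<le> k\<close> and
  \<open>2 k \<le> n + 1\<close>; outside this range the subtractions truncate, and \<open>B\<^sub>n\<^sub>,\<^sub>k\<close> occurs only
  with coefficient zero.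
\<close>

definition gamma_basis :: "nat \<Rightarrow> nat \<Rightarrow> int poly poly" where
  "gamma_basis n k = indet_t ^ (k - 1)
     * q_poch (- (indet_t * const_q ^ k)) const_q (n + 1 - 2 * k)"

lemma pcompose_gamma_basis:
  "pcompose (gamma_basis n k) (indet_t * const_q)
     = const_q ^ (k - 1) * indet_t ^ (k - 1)
       * q_poch (- (indet_t * const_q ^ Suc k)) const_q (n + 1 - 2 * k)"
  by (simp add: gamma_basis_def pcompose_mult pcompose_power pcompose_q_poch pcompose_uminus
      pcompose_indet_t power_mult_distrib mult_ac)

text \<open>
  Write \<open>n + 1 = 2 k + m\<close>. For \<open>m > 0\<close> the \<open>q\<close>-shifted factorials in \<open>B\<^sub>n\<^sub>,\<^sub>k(t)\<close>,
  \<open>B\<^sub>n\<^sub>,\<^sub>k(q t)\<close>, \<open>B\<^sub>n\<^sub>+\<^sub>1\<^sub>,\<^sub>k(t)\<close> and \<open>B\<^sub>n\<^sub>+\<^sub>1\<^sub>,\<^sub>k\<^sub>+\<^sub>1(t)\<close> share the factor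
  \<open>(- t q\<^sup>k\<^sup>+\<^sup>1; q)\<^bsub>m-1\<^esub>\<close>, which reduces the claim to an identity between polynomials of
  degree two in \<open>t\<close>. For \<open>m = 0\<close> the second summand vanishes, because \<open>[0]\<^sub>q = 0\<close>.
\<close>
lemma euler_op_gamma_basis:
  assumes "1 \<le> k" "2 * k \<le> n + 1"
  shows "euler_op n (gamma_basis n k) = (1 - const_q) *
    (q_nat const_q k * gamma_basis (Suc n) k
      + (1 + const_q ^ k) * const_q ^ k * q_nat const_q (n + 1 - 2 * k) * gamma_basis (Suc n) (Suc k))"
proof -
  let ?q = const_q and ?t = indet_t
  obtain j where k: "k = Suc j"
    using assms(1) by (cases k) auto
  define m where "m = n + 1 - 2 * k"
  have n: "Suc n = 2 * k + m"
    using assms(2) by (simp add: m_def)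
  have basis: "gamma_basis n k = ?t ^ j * q_poch (- (?t * ?q ^ k)) ?q m"
    by (simp add: gamma_basis_def m_def k)
  have shifted: "pcompose (gamma_basis n k) (?t * ?q)
      = ?q ^ j * ?t ^ j * q_poch (- (?t * ?q ^ Suc k)) ?q m"
    by (simp only: pcompose_gamma_basis m_def) (simp add: k)
  have basis_k: "gamma_basis (Suc n) k
      = ?t ^ j * (1 + ?t * ?q ^ k) * q_poch (- (?t * ?q ^ Suc k)) ?q m"
  proof -
    have "Suc n + 1 - 2 * k = Suc m"
      using n by simp
    then show ?thesis
      by (simp only: gamma_basis_def q_poch_Suc_shift) (simp add: k mult_ac)
  qed
  have basis_Suc: "gamma_basis (Suc n) (Suc k)
      = ?t ^ k * q_poch (- (?t * ?q ^ Suc k)) ?q (m - 1)"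
  proof -
    have "Suc n + 1 - 2 * Suc k = m - 1"
      using n by simp
    then show ?thesis
      by (simp add: gamma_basis_def)
  qed
  have rhs: "(1 - ?q) * (q_nat ?q k * X + (1 + ?q ^ k) * ?q ^ k * q_nat ?q m * Y)
      = (1 - ?q ^ k) * X + (1 + ?q ^ k) * ?q ^ k * (1 - ?q ^ m) * Y" for X Y
    by (simp only: q_nat_geometric[symmetric]) (simp only: algebra_simps)
  define u where "u = ?q ^ k"
  have u: "?q * ?q ^ j = u"
    by (simp add: u_def k)
  show ?thesis
  proof (cases m)
    case 0
    have qn: "?q ^ Suc n = u * u"
      by (simp only: n u_def 0 mult_2 power_add) simp
    have "euler_op n (gamma_basis n k)
        = (1 - ?t * (u * u)) * ?t ^ j - (?q * ?q ^ j) * (1 - ?t) * ?t ^ j"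
      unfolding euler_op_def shifted unfolding basis qn 0 q_poch_0
      by (simp only: algebra_simps mult_1_left mult_1_right)
    also have "\<dots> = (1 - u) * (?t ^ j * (1 + ?t * u))"
      unfolding u by (simp only: algebra_simps mult_1_left mult_1_right)
    finally show ?thesis
      unfolding m_def[symmetric] rhs basis_k by (simp add: 0 u_def)
  next
    case (Suc l)
    define w where "w = ?q ^ Suc l"
    define C where "C = q_poch (- (?t * ?q ^ Suc k)) ?q l"
    have qn: "?q ^ Suc n = u * u * w"
      by (simp only: n u_def Suc mult_2 power_add w_def)
    have P: "q_poch (- (?t * ?q ^ k)) ?q m = (1 + ?t * u) * C"
      unfolding Suc q_poch_Suc_shift C_def u_def by (simp add: mult_ac)
    have P': "q_poch (- (?t * ?q ^ Suc k)) ?q m = C * (1 + ?t * (u * w))"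
      unfolding Suc q_poch_Suc C_def u_def w_def by (simp add: mult_ac)
    have "euler_op n (gamma_basis n k)
        = ((1 - ?t * (u * u * w)) * (1 + ?t * u)
            - (?q * ?q ^ j) * (1 - ?t) * (1 + ?t * (u * w))) * (?t ^ j * C)"
      unfolding euler_op_def shifted unfolding basis qn P P'
      by (simp only: algebra_simps mult_1_left mult_1_right)
    also have "\<dots> = ((1 - u) * (1 + ?t * u) * (1 + ?t * (u * w))
          + (1 + u) * u * (1 - w) * ?t) * (?t ^ j * C)"
      unfolding u by (simp only: algebra_simps mult_1_left mult_1_right)
    also have "\<dots> = (1 - u) * (?t ^ j * (1 + ?t * u) * (C * (1 + ?t * (u * w))))
          + (1 + u) * u * (1 - w) * (?t ^ k * C)"
      by (simp only: k power_Suc) (simp only: algebra_simps mult_1_left mult_1_right)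
    finally show ?thesis
      unfolding m_def[symmetric] rhs basis_k basis_Suc P' by (simp add: Suc u_def w_def C_def)
  qed
qed

section \<open>The coefficients\<close>

text \<open>
  The coefficients \<open>a\<^sub>n\<^sub>,\<^sub>k\<close>, with the value \<open>0\<close> at \<open>n = 0\<close>. No case distinction is
  needed for large \<open>k\<close>: there the truncated subtraction gives \<open>[n + 2 - 2k]\<^sub>q = 0\<close>,
  and \<open>a\<^sub>n\<^sub>-\<^sub>1\<^sub>,\<^sub>k\<close> vanishes as well.
\<close>
fun gamma_coeff :: "nat \<Rightarrow> int \<Rightarrow> nat poly" where
  "gamma_coeff 0 k = 0"
| "gamma_coeff (Suc 0) k = (if k = 1 then 1 else 0)"
| "gamma_coeff (Suc (Suc n)) k = (if k \<le> 0 then 0 else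
     q_nat indet_q (nat k) * gamma_coeff (Suc n) k
     + (1 + indet_q ^ (nat k - 1)) * indet_q ^ (nat k - 1)
       * q_nat indet_q (Suc (Suc n) + 2 - 2 * nat k) * gamma_coeff (Suc n) (k - 1))"

lemma gamma_coeff_nonpos: "k \<le> 0 \<Longrightarrow> gamma_coeff n k = 0"
  by (cases "(n, k)" rule: gamma_coeff.cases) auto

lemma gamma_coeff_beyond: "k > int ((n + 1) div 2) \<Longrightarrow> gamma_coeff n k = 0"
proof (induction n k rule: gamma_coeff.induct)
  case (3 n k)
  have "Suc (Suc n) + 2 - 2 * nat k = 0"
    using 3(3) by (cases k) auto
  moreover have "k > int ((Suc n + 1) div 2)"
    using 3(3) by simp
  ultimately show ?case
    using 3 by (simp add: q_nat_def)
qed auto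

text \<open>The embedding of \<open>\<nat>[q]\<close> into \<open>\<int>[q][t]\<close> as the polynomials constant in \<open>t\<close>.\<close>
definition nat_const :: "nat poly \<Rightarrow> int poly poly" where
  "nat_const p = [:map_poly int p:]"

lemma nat_const_0 [simp]: "nat_const 0 = 0"
  by (simp add: nat_const_def)

lemma nat_const_hom:
  "nat_const (p + r) = nat_const p + nat_const r"
  "nat_const (p * r) = nat_const p * nat_const r"
  "nat_const 1 = 1"
  "nat_const indet_q = const_q"
proof -
  have "map_poly int (p + r) = map_poly int p + map_poly int r"
    by (rule poly_eqI) (simp add: coeff_map_poly)
  then show "nat_const (p + r) = nat_const p + nat_const r"
    by (simp add: nat_const_def)
  have "map_poly int (p * r) = map_poly int p * map_poly int r"
    by (rule poly_eqI) (simp add: coeff_map_poly coeff_mult)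
  then show "nat_const (p * r) = nat_const p * nat_const r"
    by (simp add: nat_const_def)
  show "nat_const 1 = 1" "nat_const indet_q = const_q"
    by (simp_all add: nat_const_def const_q_def one_pCons indet_q_def map_poly_pCons)
qed

lemma nat_const_power: "nat_const (p ^ m) = nat_const p ^ m"
  by (induction m) (simp_all only: power_0 power_Suc nat_const_hom)

lemma nat_const_q_nat: "nat_const (q_nat indet_q m) = q_nat const_q m"
proof (induction m)
  case (Suc m)
  then show ?case
    by (simp only: q_nat_Suc nat_const_hom nat_const_power)
qed (simp add: q_nat_def)

lemma nat_const_gamma_coeff_Suc:
  assumes "n \<ge> 1"
  shows "nat_const (gamma_coeff (Suc n) (int (Suc k)))
    = q_nat const_q (Suc k) * nat_const (gamma_coeff n (int (Suc k)))
      + (1 + const_q ^ k) * const_q ^ k * q_nat const_q (n + 1 - 2 * k)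
        * nat_const (gamma_coeff n (int k))"
proof -
  obtain l where n: "n = Suc l"
    using assms by (cases n) auto
  have "gamma_coeff (Suc n) (int (Suc k))
    = q_nat indet_q (Suc k) * gamma_coeff n (int (Suc k))
      + (1 + indet_q ^ k) * indet_q ^ k * q_nat indet_q (n + 1 - 2 * k) * gamma_coeff n (int k)"
    unfolding n by (simp add: nat_add_distrib)
  then show ?thesis
    by (simp only: nat_const_hom nat_const_power nat_const_q_nat)
qed

section \<open>The expansion\<close>

text \<open>
  Summing up to any \<open>N \<ge> n\<close> avoids boundary terms in the reindexing; the additional
  coefficients vanish.
\<close>
lemma q_eulerian_gamma_expansion:
  assumes "n \<ge> 1" "n \<le> N"
  shows "q_eulerian n = (\<Sum>k\<le>N. nat_const (gamma_coeff n (int k)) * gamma_basis n k)"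
  using assms
proof (induction n arbitrary: N rule: nat_induct_at_least)
  case base
  \<comment> \<open>The expansion fails for \<open>n = 0\<close>, where the right-hand side is \<open>0\<close> and \<open>A\<^sub>0 = 1\<close>;
    \<open>A\<^sub>1\<close> is computed from \<open>A\<^sub>0\<close>.\<close>
  have "q_eulerian 0 = 1"
  proof -
    have "q_poch indet_t const_q 1 = [:1, - 1:]"
      by (simp add: q_poch_def indet_t_def one_pCons)
    then have "fps_of_poly (q_eulerian 0) = fps_of_poly 1"
      using q_eulerian_generating_function[of 0] geometric_fps[of "1 :: int poly"]
      by (simp add: const_q_def)
    then show ?thesis
      by (simp only: fps_of_poly_eq_iff)
  qed
  moreover have "euler_op 0 1 = 1 - const_q"
    by (simp add: euler_op_def pcompose_1 algebra_simps)
  ultimately have "(1 - const_q) * q_eulerian 1 = 1 - const_q"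
    using q_eulerian_Suc[of 0] by simp
  then have "q_eulerian 1 = 1"
    using one_minus_const_q_nonzero by simp
  moreover have "(\<Sum>k\<le>N. nat_const (gamma_coeff 1 (int k)) * gamma_basis 1 k)
      = (\<Sum>k\<in>{1}. nat_const (gamma_coeff 1 (int k)) * gamma_basis 1 k)"
    using base by (intro sum.mono_neutral_right) auto
  moreover have "nat_const (gamma_coeff 1 1) = 1"
    by (simp add: nat_const_hom(3))
  ultimately show ?case
    by (simp add: gamma_basis_def del: One_nat_def)
next
  case (Suc n)
  then obtain M where N: "N = Suc M" and M: "n \<le> M"
    by (cases N) auto
  define a where "a k = nat_const (gamma_coeff n (int k))" for k
  \<comment> \<open>The contributions of \<open>a\<^sub>n\<^sub>,\<^sub>k\<close> to \<open>B\<^sub>n\<^sub>+\<^sub>1\<^sub>,\<^sub>k\<close> and to \<open>B\<^sub>n\<^sub>+\<^sub>1\<^sub>,\<^sub>k\<^sub>+\<^sub>1\<close>.\<close>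
  define X where "X k = a k * (q_nat const_q k * gamma_basis (Suc n) k)" for k
  define Y where "Y k = a k * ((1 + const_q ^ k) * const_q ^ k * q_nat const_q (n + 1 - 2 * k)
      * gamma_basis (Suc n) (Suc k))" for k
  have a_0: "a 0 = 0"
    by (simp add: a_def gamma_coeff_nonpos)
  have a_beyond: "a k = 0" if "2 * k > n + 1" for k
  proof -
    have "gamma_coeff n (int k) = 0"
      using that by (intro gamma_coeff_beyond) linarith
    then show ?thesis
      by (simp add: a_def)
  qed
  have summand: "a k * euler_op n (gamma_basis n k) = (1 - const_q) * (X k + Y k)" for k
  proof (cases "1 \<le> k \<and> 2 * k \<le> n + 1")
    case True
    then show ?thesis
      by (simp only: euler_op_gamma_basis X_def Y_def) (simp only: algebra_simps)
  next
    case False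
    then have "a k = 0"
      using a_0 a_beyond[of k] by (cases k) auto
    then show ?thesis
      by (simp add: X_def Y_def)
  qed
  have "(1 - const_q) * q_eulerian (Suc n) = euler_op n (\<Sum>k\<le>M. a k * gamma_basis n k)"
    unfolding q_eulerian_Suc a_def using Suc.IH[OF M] by simp
  also have "\<dots> = (\<Sum>k\<le>M. a k * euler_op n (gamma_basis n k))"
    unfolding a_def nat_const_def by (rule euler_op_sum)
  also have "\<dots> = (1 - const_q) * ((\<Sum>k\<le>M. X k) + (\<Sum>k\<le>M. Y k))"
    by (simp only: summand flip: sum_distrib_left sum.distrib)
  \<comment> \<open>After this shift, the terms of index \<open>k\<close> of both sums are multiples of \<open>B\<^sub>n\<^sub>+\<^sub>1\<^sub>,\<^sub>k\<^sub>+\<^sub>1\<close>.\<close>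
  also have "(\<Sum>k\<le>M. X k) = (\<Sum>k\<le>M. X (Suc k))"
  proof -
    have "X 0 = 0" "X (Suc M) = 0"
      using M Suc.hyps by (simp_all add: X_def a_0 a_beyond)
    then show ?thesis
      using sum.atMost_Suc_shift[of X M] by simp
  qed
  also have "(\<Sum>k\<le>M. X (Suc k)) + (\<Sum>k\<le>M. Y k)
      = (\<Sum>k\<le>M. nat_const (gamma_coeff (Suc n) (int (Suc k))) * gamma_basis (Suc n) (Suc k))"
    unfolding sum.distrib[symmetric] nat_const_gamma_coeff_Suc[OF Suc.hyps] X_def Y_def a_def
    by (intro sum.cong refl) (simp only: algebra_simps)
  also have "\<dots> = (\<Sum>k\<le>N. nat_const (gamma_coeff (Suc n) (int k)) * gamma_basis (Suc n) k)"
    unfolding N sum.atMost_Suc_shift by (simp add: gamma_coeff_nonpos)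
  finally show ?case
    using one_minus_const_q_nonzero by simp
qed

theorem theorem1:
  "\<exists>a :: nat \<Rightarrow> int \<Rightarrow> nat poly.
     (\<forall>n\<ge>1. q_eulerian n =
        (\<Sum>k = 1..(n + 1) div 2.
           [:map_poly int (a n (int k)):] * indet_t ^ (k - 1)
             * q_poch (- (indet_t * [:indet_q:] ^ k)) [:indet_q:] (n + 1 - 2 * k))) \<and>
     (\<forall>n\<ge>2. \<forall>k\<in>{1..(n + 1) div 2}.
        a n (int k) = q_nat indet_q k * a (n - 1) (int k)
          + (1 + indet_q ^ (k - 1)) * indet_q ^ (k - 1) * q_nat indet_q (n + 2 - 2 * k)
            * a (n - 1) (int k - 1)) \<and>
     a 1 1 = 1 \<and>
     (\<forall>n\<ge>1. \<forall>k. k \<le> 0 \<or> k > int ((n + 1) div 2) \<longrightarrow> a n k = 0)"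
proof (intro exI[of _ gamma_coeff] conjI allI impI ballI)
  fix n :: nat
  assume n: "n \<ge> 1"
  have "q_eulerian n = (\<Sum>k\<le>n. nat_const (gamma_coeff n (int k)) * gamma_basis n k)"
    using n by (rule q_eulerian_gamma_expansion) simp
  also have "\<dots> = (\<Sum>k = 1..(n + 1) div 2. nat_const (gamma_coeff n (int k)) * gamma_basis n k)"
  proof (rule sum.mono_neutral_right)
    show "{1..(n + 1) div 2} \<subseteq> {..n}"
      using n by auto
    show "\<forall>k\<in>{..n} - {1..(n + 1) div 2}. nat_const (gamma_coeff n (int k)) * gamma_basis n k = 0"
    proof
      fix k
      assume "k \<in> {..n} - {1..(n + 1) div 2}"
      then have "int k \<le> 0 \<or> int k > int ((n + 1) div 2)"
        by auto
      then have "gamma_coeff n (int k) = 0"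
        using gamma_coeff_nonpos gamma_coeff_beyond by blast
      then show "nat_const (gamma_coeff n (int k)) * gamma_basis n k = 0"
        by simp
    qed
  qed simp
  finally show "q_eulerian n =
        (\<Sum>k = 1..(n + 1) div 2.
           [:map_poly int (gamma_coeff n (int k)):] * indet_t ^ (k - 1)
             * q_poch (- (indet_t * [:indet_q:] ^ k)) [:indet_q:] (n + 1 - 2 * k))"
    by (simp only: gamma_basis_def nat_const_def const_q_def mult.assoc)
next
  fix n k :: nat
  assume n: "n \<ge> 2" and k: "k \<in> {1..(n + 1) div 2}"
  obtain l where l: "n = Suc (Suc l)"
    using n by (metis One_nat_def Suc_1 Suc_le_D Suc_le_mono)
  show "gamma_coeff n (int k) = q_nat indet_q k * gamma_coeff (n - 1) (int k)
          + (1 + indet_q ^ (k - 1)) * indet_q ^ (k - 1) * q_nat indet_q (n + 2 - 2 * k)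
            * gamma_coeff (n - 1) (int k - 1)"
    using k by (simp add: l)
next
  fix n :: nat and k :: int
  assume "k \<le> 0 \<or> k > int ((n + 1) div 2)"
  then show "gamma_coeff n k = 0"
    using gamma_coeff_nonpos gamma_coeff_beyond by blast
qed simp

end
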